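(* Let $\{p_n\}_{n\ge0}$ be orthogonal polynomials with respect to the inner product $\langle f,g\rangle=\int_{\mathbb{R}}f(x)g(x)\,d\mu(x)$, with three-term recurrence relation $xp_n(x)=A_np_{n+1}(x)+B_np_n(x)+C_np_{n-1}(x)$, and let $X$ be the operator $(Xf)(x)=xf(x)$ on $\mathbb{R}[x]$. Let $D$ be a linear operator acting on $\mathbb{R}[x]$ which is symmetric, i.e. $\langle Df,g\rangle=\langle f,Dg\rangle$ for all $f,g\in\mathbb{R}[x]$, and which satisfies for all $n\ge0$ $$D(x^n)=\lambda_nx^n+\text{terms of lower degree},$$ where $\lambda_n\ne\lambda_{n-1}$ for $n\ge1$. Then $p_n$ is an eigenfunction of $D$: $Dp_n=\lambda_np_n$; and the commutator $$L:=[D,X]=DX-XD$$ is skew symmetric, i.e. $\langle Lf,g\rangle=-\langle f,Lg\rangle$ for all $f,g\in\mathbb{R}[x]$, and satisfies $$L(x^n)=\gamma_nx^{n+1}+\text{terms of lower degree},\qquad \gamma_n=\lambda_{n+1}-\lambda_n\ne0\qquad(n\ge0).$$ So $L$ also satisfies the structure relation $(Lp_n)(x)=\gamma_nA_np_{n+1}(x)-\gamma_{n-1}C_np_{n-1}(x)$ for all $n\ge0$.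
   Context: $\mu$ is an orthogonality measure on $\mathbb{R}$ (a positive measure with infinite support and all moments finite), and $p_n\in\mathbb{R}[x]$ satisfy $p_n(x)=k_nx^n+\cdots$ with $k_n\ne0$ and $\langle p_n,p_m\rangle=h_n\delta_{n,m}$. Then $A_n=k_n/k_{n+1}$ and $C_n=A_{n-1}h_n/h_{n-1}$ ($n\ge1$). Convention: $p_{-1}:=0$ and the term containing $p_{-1}$ is $0$. *)

theory Defs
  imports "HOL-Analysis.Analysis" "HOL-Computational_Algebra.Polynomial"
begin

definition measure_support :: "'a::topological_space measure \<Rightarrow> 'a set" where
  "measure_support M = {x. \<forall>U. open U \<longrightarrow> x \<in> U \<longrightarrow> emeasure M U > 0}"

definition orthogonality_measure :: "real measure \<Rightarrow> bool" where
  "orthogonality_measure M \<longleftrightarrow>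
     sets M = sets borel \<and> infinite (measure_support M) \<and> (\<forall>n::nat. integrable M (\<lambda>x. x ^ n))"

definition poly_inner :: "real measure \<Rightarrow> real poly \<Rightarrow> real poly \<Rightarrow> real" where
  "poly_inner M f g = (\<integral>x. poly f x * poly g x \<partial>M)"

definition orthogonal_polys ::
  "real measure \<Rightarrow> (nat \<Rightarrow> real poly) \<Rightarrow> (nat \<Rightarrow> real) \<Rightarrow> (nat \<Rightarrow> real) \<Rightarrow> bool" where
  "orthogonal_polys M p k h \<longleftrightarrow>
     (\<forall>n. degree (p n) = n \<and> coeff (p n) n = k n \<and> k n \<noteq> 0) \<and>
     (\<forall>n m. poly_inner M (p n) (p m) = (if n = m then h n else 0))"

definition poly_linear :: "(real poly \<Rightarrow> real poly) \<Rightarrow> bool" where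
  "poly_linear T \<longleftrightarrow> Vector_Spaces.linear smult smult T"

definition symmetric_op :: "real measure \<Rightarrow> (real poly \<Rightarrow> real poly) \<Rightarrow> bool" where
  "symmetric_op M T \<longleftrightarrow> (\<forall>f g. poly_inner M (T f) g = poly_inner M f (T g))"

definition skew_symmetric_op :: "real measure \<Rightarrow> (real poly \<Rightarrow> real poly) \<Rightarrow> bool" where
  "skew_symmetric_op M T \<longleftrightarrow> (\<forall>f g. poly_inner M (T f) g = - poly_inner M f (T g))"

definition mult_X :: "real poly \<Rightarrow> real poly" where
  "mult_X f = [:0, 1:] * f"

definition commutator ::
  "(real poly \<Rightarrow> real poly) \<Rightarrow> (real poly \<Rightarrow> real poly) \<Rightarrow> real poly \<Rightarrow> real poly" where
  "commutator S T = (\<lambda>f. S (T f) - T (S f))"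

(* f = c x^n + terms of lower degree. The case q = 0 is listed separately because
   degree 0 = 0 in the library; for n = 0 it is the only possibility. The
   coefficient c may vanish, so this does not assert degree f = n. *)
definition has_top_term :: "real poly \<Rightarrow> real \<Rightarrow> nat \<Rightarrow> bool" where
  "has_top_term f c n \<longleftrightarrow> (\<exists>q. f = monom c n + q \<and> (q = 0 \<or> degree q < n))"

(* The sequence n \<mapsto> p_{n-1}, with the convention p_{-1} = 0. *)
definition prev_poly :: "(nat \<Rightarrow> real poly) \<Rightarrow> nat \<Rightarrow> real poly" where
  "prev_poly p n = (if n = 0 then 0 else p (n - 1))"

end

theory Submission
  imports Defs
begin

text \<open>
  Set \<^term>\<open>q = D (p n) - smult (lam n) (p n)\<close>. It has degree less than \<^term>\<open>n\<close>, and so has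
  \<^term>\<open>D q\<close>, hence both are orthogonal to \<^term>\<open>p n\<close>. By symmetry
  \<open>\<langle>q, q\<rangle> = \<langle>p\<^sub>n, D q\<rangle> - \<lambda>\<^sub>n \<langle>p\<^sub>n, q\<rangle> = 0\<close>, and since the support is infinite the inner
  product is definite, so \<^term>\<open>q = 0\<close>. The claims about the commutator are then formal: \<open>X\<close> is
  symmetric, and the structure relation results from applying \<open>D\<close> to the three-term recurrence.
\<close>

text \<open>Coefficient conditions are easier to combine than an existential remainder. In
  particular \<open>has_top_term f 0 n\<close> becomes a degree bound below \<open>n\<close> that
  for \<open>n = 0\<close> correctly forces \<open>f = 0\<close>.\<close>

lemma has_top_term_iff:
  "has_top_term f c n \<longleftrightarrow> coeff f n = c \<and> (\<forall>i>n. coeff f i = 0)"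
proof
  assume "has_top_term f c n"
  then obtain q where "f = monom c n + q" "q = 0 \<or> degree q < n"
    unfolding has_top_term_def by blast
  then show "coeff f n = c \<and> (\<forall>i>n. coeff f i = 0)"
    by (auto simp: coeff_eq_0)
next
  assume *: "coeff f n = c \<and> (\<forall>i>n. coeff f i = 0)"
  have "degree (f - monom c n) < n" if "f - monom c n \<noteq> 0"
  proof (rule ccontr)
    assume "\<not> degree (f - monom c n) < n"
    then have "coeff (f - monom c n) (degree (f - monom c n)) = 0"
      using * by (cases "degree (f - monom c n) = n") auto
    with that show False
      using leading_coeff_0_iff by blast
  qed
  then show "has_top_term f c n"
    unfolding has_top_term_def by (intro exI[of _ "f - monom c n"]) auto
qed

lemma sets_orthogonality_measure: "orthogonality_measure M \<Longrightarrow> sets M = sets borel"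
  by (simp add: orthogonality_measure_def)

lemma integrable_poly:
  fixes f :: "real poly"
  assumes "orthogonality_measure M"
  shows "integrable M (poly f)"
proof -
  have "integrable M (\<lambda>x. \<Sum>i\<le>degree f. coeff f i * x ^ i)"
    using assms unfolding orthogonality_measure_def
    by (intro Bochner_Integration.integrable_sum integrable_mult_right) auto
  then show ?thesis
    by (simp add: poly_altdef[abs_def])
qed

lemma poly_inner_eq: "poly_inner M f g = (\<integral>x. poly (f * g) x \<partial>M)"
  by (simp add: poly_inner_def)

lemma poly_inner_commute: "poly_inner M f g = poly_inner M g f"
  by (simp add: poly_inner_eq mult.commute)

lemma poly_inner_diff_left:
  assumes "orthogonality_measure M"
  shows "poly_inner M (f - g) q = poly_inner M f q - poly_inner M g q"
  unfolding poly_inner_eq left_diff_distrib poly_diff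
  by (intro Bochner_Integration.integral_diff integrable_poly assms)

lemma poly_inner_diff_right:
  assumes "orthogonality_measure M"
  shows "poly_inner M q (f - g) = poly_inner M q f - poly_inner M q g"
  using poly_inner_diff_left[OF assms] by (simp add: poly_inner_commute[of M q])

lemma poly_inner_smult_left: "poly_inner M (smult c f) g = c * poly_inner M f g"
  by (simp add: poly_inner_def mult.assoc)

lemma poly_inner_smult_right: "poly_inner M f (smult c g) = c * poly_inner M f g"
  using poly_inner_smult_left[of M c g f] by (simp add: poly_inner_commute[of M f])

lemma symmetric_mult_X: "symmetric_op M mult_X"
  by (simp add: symmetric_op_def poly_inner_def mult_X_def ac_simps)

text \<open>A nonzero \<open>f\<close> has finitely many roots, so some support point is not a root.
  The open set of non-roots then has positive measure, whereas a vanishing integral of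
  \<open>f * f\<close> makes it a null set.\<close>

lemma poly_inner_self_eq_0:
  assumes M: "orthogonality_measure M" and 0: "poly_inner M f f = 0"
  shows "f = 0"
proof (rule ccontr)
  assume "f \<noteq> 0"
  then have "finite {x. poly f x = 0}"
    by (rule poly_roots_finite)
  moreover have "infinite (measure_support M)"
    using M by (simp add: orthogonality_measure_def)
  ultimately have "\<not> measure_support M \<subseteq> {x. poly f x = 0}"
    using finite_subset by blast
  then obtain x where x: "x \<in> measure_support M" "poly f x \<noteq> 0"
    by blast
  have open_U: "open {x. poly f x \<noteq> 0}"
    by (intro open_Collect_neq continuous_intros)
  have "AE x in M. poly (f * f) x = 0"
    using 0 integral_nonneg_eq_0_iff_AE[OF integrable_poly[OF M, of "f * f"]]
    by (simp add: poly_inner_def poly_mult[abs_def])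
  then have "AE x in M. \<not> poly f x \<noteq> 0"
    by simp
  moreover have "{x \<in> space M. poly f x \<noteq> 0} = {x. poly f x \<noteq> 0}"
    using sets_eq_imp_space_eq[OF sets_orthogonality_measure[OF M]] by simp
  moreover have "{x. poly f x \<noteq> 0} \<in> sets M"
    using open_U sets_orthogonality_measure[OF M] by simp
  ultimately have "emeasure M {x. poly f x \<noteq> 0} = 0"
    by (simp add: AE_iff_measurable[OF _ refl])
  moreover have "emeasure M {x. poly f x \<noteq> 0} > 0"
    using x open_U unfolding measure_support_def by blast
  ultimately show False by simp
qed

lemma orthogonal_polys_lower_degree:
  assumes M: "orthogonality_measure M" and p: "orthogonal_polys M p k h"
    and "\<forall>i\<ge>n. coeff f i = 0"
  shows "poly_inner M (p n) f = 0"
proof -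
  \<comment> \<open>Induction on a degree bound \<open>m\<close> with \<open>n\<close> fixed;
    \<open>m \<le> n\<close> ensures that only \<open>p i\<close> with \<open>i < n\<close> are
    subtracted, all orthogonal to \<open>p n\<close>.\<close>
  have "poly_inner M (p n) f = 0" if "m \<le> n" "\<forall>i\<ge>m. coeff f i = 0" for m
    using that
  proof (induction m arbitrary: f)
    case 0
    then have "f = 0" by (simp add: poly_eq_iff)
    then show ?case by (simp add: poly_inner_def)
  next
    case (Suc m)
    have pm: "degree (p m) = m" "coeff (p m) m = k m" "k m \<noteq> 0"
      and orth: "poly_inner M (p n) (p m) = 0"
      using p Suc.prems(1) by (auto simp: orthogonal_polys_def)
    \<comment> \<open>The multiple of \<open>p m\<close> is chosen to cancel the coefficient of
      \<open>f\<close> at \<open>m\<close>.\<close>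
    define g where "g = f - smult (coeff f m / k m) (p m)"
    have "coeff g i = 0" if "i \<ge> m" for i
      using that Suc.prems(2) pm
      by (cases "i = m") (auto simp: g_def coeff_eq_0)
    then have "poly_inner M (p n) g = 0"
      using Suc by simp
    then show ?case
      by (simp add: g_def poly_inner_diff_right[OF M] poly_inner_smult_right orth)
  qed
  with assms(3) show ?thesis by blast
qed

lemma
  assumes "poly_linear T"
  shows poly_linear_add: "T (f + g) = T f + T g"
    and poly_linear_smult: "T (smult c f) = smult c (T f)"
    and poly_linear_sum: "T (sum F I) = (\<Sum>i\<in>I. T (F i))"
    and poly_linear_0: "T 0 = 0"
proof -
  interpret Vector_Spaces.linear smult smult T
    using assms by (simp add: poly_linear_def)
  show "T (f + g) = T f + T g" "T (smult c f) = smult c (T f)"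
    "T (sum F I) = (\<Sum>i\<in>I. T (F i))" "T 0 = 0"
    by (simp_all add: add scale sum zero)
qed

text \<open>Since \<open>c\<close> may be 0, this also shows that \<open>T\<close> preserves the
  property of having degree below \<open>n\<close>, which is needed for \<open>T q\<close> in the
  eigenvalue argument.\<close>

lemma has_top_term_poly_linear:
  assumes T: "poly_linear T" and top: "\<And>n. has_top_term (T (monom 1 n)) (lam n) n"
    and f: "has_top_term f c n"
  shows "has_top_term (T f) (lam n * c) n"
proof -
  have deg: "degree f \<le> n" and c: "coeff f n = c"
    using f by (auto simp: has_top_term_iff intro: degree_le)
  have "f = (\<Sum>i\<le>n. smult (coeff f i) (monom 1 i))"
    using poly_as_sum_of_monoms'[OF deg] by (simp add: smult_monom)
  then have "T f = T (\<Sum>i\<le>n. smult (coeff f i) (monom 1 i))"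
    by simp
  then have Tf: "T f = (\<Sum>i\<le>n. smult (coeff f i) (T (monom 1 i)))"
    by (simp add: poly_linear_sum[OF T] poly_linear_smult[OF T])
  have "coeff (T f) j = (if j = n then lam n * c else 0)" if "j \<ge> n" for j
  proof -
    \<comment> \<open>As \<open>i \<le> n \<le> j\<close>, the image of the \<open>i\<close>-th
      monomial reaches exponent \<open>j\<close> only if \<open>i = j\<close>.\<close>
    have "coeff (T f) j = (\<Sum>i\<le>n. coeff f i * (if i = j then lam i else 0))"
      unfolding Tf coeff_sum using top that
      by (intro sum.cong) (auto simp: has_top_term_iff)
    also have "\<dots> = (\<Sum>i\<le>n. if i = j then coeff f i * lam i else 0)"
      by (intro sum.cong) auto
    also have "\<dots> = (if j = n then lam n * c else 0)"
      using that c by auto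
    finally show ?thesis .
  qed
  then show ?thesis by (simp add: has_top_term_iff)
qed

lemma symmetric_op_eigen:
  assumes M: "orthogonality_measure M" and p: "orthogonal_polys M p k h"
    and T: "poly_linear T" and sym: "symmetric_op M T"
    and top: "\<And>n. has_top_term (T (monom 1 n)) (lam n) n"
  shows "T (p n) = smult (lam n) (p n)"
proof -
  define q where "q = T (p n) - smult (lam n) (p n)"
  have pn: "has_top_term (p n) (k n) n"
    using p by (auto simp: has_top_term_iff orthogonal_polys_def coeff_eq_0)
  have q: "has_top_term q 0 n"
    using has_top_term_poly_linear[OF T top pn] pn by (simp add: has_top_term_iff q_def)
  have "has_top_term (T q) 0 n"
    using has_top_term_poly_linear[OF T top q] by simp
  with q have "poly_inner M (p n) q = 0" "poly_inner M (p n) (T q) = 0"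
    by (auto simp: has_top_term_iff le_less intro!: orthogonal_polys_lower_degree[OF M p])
  moreover have "poly_inner M (T (p n)) q = poly_inner M (p n) (T q)"
    using sym by (simp add: symmetric_op_def)
  ultimately have "poly_inner M q q = 0"
    by (subst (1) q_def) (simp add: poly_inner_diff_left[OF M] poly_inner_smult_left)
  then have "q = 0"
    by (rule poly_inner_self_eq_0[OF M])
  then show ?thesis by (simp add: q_def)
qed

text \<open>Moving \<open>S\<close> and \<open>T\<close> across the inner product reverses their
  order, which flips the sign of the commutator.\<close>

lemma skew_symmetric_commutator:
  assumes M: "orthogonality_measure M" and "symmetric_op M S" "symmetric_op M T"
  shows "skew_symmetric_op M (commutator S T)"
  using assms(2,3)
  by (simp add: skew_symmetric_op_def symmetric_op_def commutator_def
      poly_inner_diff_left[OF M] poly_inner_diff_right[OF M])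

lemma has_top_term_mult_X: "has_top_term f c n \<Longrightarrow> has_top_term (mult_X f) c (n + 1)"
  by (auto simp: has_top_term_iff mult_X_def coeff_pCons split: nat.split)

lemma mult_X_monom: "mult_X (monom c n) = monom c (n + 1)"
  by (simp add: mult_X_def monom_Suc)

lemma mult_X_smult: "mult_X (smult c f) = smult c (mult_X f)"
  by (simp add: mult_X_def)

theorem proposition2p2:
  fixes \<mu> :: "real measure"
    and p :: "nat \<Rightarrow> real poly"
    and k h A B C lam :: "nat \<Rightarrow> real"
    and D :: "real poly \<Rightarrow> real poly"
  assumes "orthogonality_measure \<mu>"
    and "orthogonal_polys \<mu> p k h"
    and "\<And>n. mult_X (p n) =
           smult (A n) (p (n + 1)) + smult (B n) (p n) + smult (C n) (prev_poly p n)"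
    and "poly_linear D"
    and "symmetric_op \<mu> D"
    and "\<And>n. has_top_term (D (monom 1 n)) (lam n) n"
    and "\<And>n. n \<ge> 1 \<Longrightarrow> lam n \<noteq> lam (n - 1)"
  shows "let L = commutator D mult_X; \<gamma> = (\<lambda>n. lam (n + 1) - lam n) in
           (\<forall>n. D (p n) = smult (lam n) (p n)) \<and>
           skew_symmetric_op \<mu> L \<and>
           (\<forall>n. has_top_term (L (monom 1 n)) (\<gamma> n) (n + 1) \<and> \<gamma> n \<noteq> 0) \<and>
           (\<forall>n. L (p n) =
              smult (\<gamma> n * A n) (p (n + 1)) - smult (\<gamma> (n - 1) * C n) (prev_poly p n))"
proof -
  define L where "L = commutator D mult_X"
  define \<gamma> where "\<gamma> = (\<lambda>n. lam (n + 1) - lam n)"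
  note linear = poly_linear_add[OF assms(4)] poly_linear_smult[OF assms(4)]
    poly_linear_0[OF assms(4)]
  have eigen: "D (p n) = smult (lam n) (p n)" for n
    by (rule symmetric_op_eigen[OF assms(1,2,4,5,6)])
  have skew: "skew_symmetric_op \<mu> L"
    unfolding L_def by (rule skew_symmetric_commutator[OF assms(1,5) symmetric_mult_X])
  \<comment> \<open>At exponent \<open>n + 1\<close>, \<open>D\<close> after \<open>mult_X\<close>
    contributes \<open>lam (n + 1)\<close> and \<open>mult_X\<close> after \<open>D\<close>
    contributes \<open>lam n\<close>.\<close>
  have top: "has_top_term (L (monom 1 n)) (\<gamma> n) (n + 1)" for n
    using assms(6)[of "n + 1"] has_top_term_mult_X[OF assms(6)[of n]]
    by (simp add: L_def \<gamma>_def commutator_def mult_X_monom has_top_term_iff)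
  have nonzero: "\<gamma> n \<noteq> 0" for n
    using assms(7)[of "n + 1"] by (simp add: \<gamma>_def)
  have struct_rel: "L (p n) =
      smult (\<gamma> n * A n) (p (n + 1)) - smult (\<gamma> (n - 1) * C n) (prev_poly p n)" for n
  proof -
    \<comment> \<open>For \<open>n = 0\<close> the index \<open>n - 1\<close> is truncated to 0, but
      both sides are 0.\<close>
    have prev: "D (prev_poly p n) = smult (lam (n - 1)) (prev_poly p n)"
      by (simp add: prev_poly_def eigen linear)
    have "L (p n) = D (mult_X (p n)) - smult (lam n) (mult_X (p n))"
      by (simp add: L_def commutator_def eigen mult_X_smult)
    \<comment> \<open>Expanding by the recurrence, each term is scaled by its eigenvalue minus
      \<open>lam n\<close>, so the \<open>B n\<close> term drops out.\<close>
    also have "\<dots> = smult (\<gamma> n * A n) (p (n + 1)) + smult (C n * (lam (n - 1) - lam n)) (prev_poly p n)"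
      unfolding assms(3) linear eigen prev
      by (simp add: \<gamma>_def smult_add_right smult_diff_left algebra_simps)
    \<comment> \<open>For \<open>n = 0\<close> the scalars can differ, as
      \<open>\<gamma> (n - 1)\<close> is then \<open>\<gamma> 0\<close>; the equation holds because
      \<open>prev_poly p 0 = 0\<close>.\<close>
    also have "smult (C n * (lam (n - 1) - lam n)) (prev_poly p n) =
        - smult (\<gamma> (n - 1) * C n) (prev_poly p n)"
      by (cases n) (simp_all add: prev_poly_def \<gamma>_def algebra_simps flip: smult_minus_left)
    finally show ?thesis by simp
  qed
  show ?thesis
    using eigen skew top nonzero struct_rel by (simp add: L_def \<gamma>_def Let_def)
qed

end
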